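(* Let $k\ge1$ be an integer and let $d\in A_k$ with $d\to(P,Q)$ under the insertion map defined in the context. Let $(P_d,Q_d)$ be the pair of chains of partitions read off the growth diagram $G_d$ as defined in the context. Then $P_d=P$ and $Q_d=Q$.
   Context: $A_k$ is the set of set partitions of $\{1,\ldots,k,1',\ldots,k'\}$. Standard representation of $d\in A_k$: relabel the vertex $j'$ as $2k-j+1$, so that $d$ becomes a set partition of $\{1,\ldots,2k\}$, drawn with vertices in a row. Connect $i<j$ by an edge if and only if $i,j$ are in the same block and no $m$ with $i<m<j$ is in that block. Label each edge by $2k+1-\ell$, where $\ell$ is its right (larger) endpoint. Each vertex is the left endpoint of at most one edge and the right endpoint of at most one edge. Insertion sequence of $d$: $E=(E_{1/2},E_1,E_{3/2},\ldots,E_{2k-1/2},E_{2k})$, where for each integer $1\le j\le 2k$: $E_j=a$ if vertex $j$ is the left endpoint of the edge labeled $a$, and $E_j=\emptyset$ if $j$ is not a left endpoint; $E_{j-1/2}=a$ if vertex $j$ is the right endpoint of the edge labeled $a$, and $E_{j-1/2}=\emptyset$ if $j$ is not a right endpoint. A "tableau" is a filling of a Young diagram (English convention) by distinct positive integers increasing along rows and down columns. Jeu de taquin deletion of an entry $x$: while the box of $x$ is not a corner (end of both its row and column), exchange $x$ with the smaller of the entries immediately below and immediately to the right (or the only one that exists); then delete the corner containing $x$. RSK row insertion of $x$: let $R$ be the first row; while $x$ is less than some element of $R$, replace the smallest element $y>x$ of $R$ by $x$, set $x:=y$, and let $R$ be the next row; finally place $x$ at the end of $R$. Insertion map: let $T^{(0)}=\emptyset$.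 For $0\le j\le 2k-1$, $T^{(j+1/2)}$ is $T^{(j)}$ with $E_{j+1/2}$ deleted by jeu de taquin if $E_{j+1/2}\ne\emptyset$, and $T^{(j+1/2)}=T^{(j)}$ otherwise; $T^{(j+1)}$ is $T^{(j+1/2)}$ with $E_{j+1}$ row-inserted if $E_{j+1}\neq\emptyset$, and $T^{(j+1)}=T^{(j+1/2)}$ otherwise. Let $\lambda^{(i)}$ be the shape of $T^{(i)}$ for all $i\in\{0,\frac12,1,\ldots,2k\}$. Put $Q=(\lambda^{(0)},\lambda^{(1/2)},\ldots,\lambda^{(k-1/2)},\lambda^{(k)})$ and $P=(\lambda^{(2k)},\lambda^{(2k-1/2)},\ldots,\lambda^{(k+1/2)},\lambda^{(k)})$. One writes $d\to(P,Q)$. Growth diagram $G_d$: consider the lattice points $(a,b)\in\mathbb{Z}^2$ with $a,b\ge0$, $a+b\le 2k$, and the unit boxes with all four corners among these points; the box in column $i$ and row $j$ has lower-left corner $(i-1,j-1)$ and upper-right corner $(i,j)$ (columns numbered left to right, rows bottom to top). Place an X in the box in column $i$, row $j$ if and only if, in the standard representation of $d$, vertex $i$ is the left endpoint of the edge labeled $j$. Label all points $(a,0)$ and $(0,b)$ with the empty partition. Label the other points inductively: if a box has lower-left label $\lambda$, lower-right label $\mu$, upper-left label $\nu$, its upper-right label $\rho$ is determined by: (L1) if $\mu\ne\nu$, $\rho=\mu\cup\nu$, i.e. $\rho_i=\max(\mu_i,\nu_i)$; (L2) if $\mu=\nu$ and $\lambda\subset\mu$, $\lambda\neq\mu$, then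 $\mu$ is obtained from $\lambda$ by adding a box in some row $i$, and $\rho$ is obtained from $\mu$ by adding a box in row $i+1$; (L3) if $\mu=\nu=\lambda$, then $\rho=\lambda$ if the box contains no X, and $\rho$ is obtained from $\lambda$ by adding $1$ to $\lambda_1$ if the box contains an X. $Q_d$ is the sequence of labels along the staircase path $(0,2k),(0,2k-1),(1,2k-1),(1,2k-2),\ldots,(k-1,k),(k,k)$, and $P_d$ is the sequence of labels along the staircase path $(2k,0),(2k-1,0),(2k-1,1),(2k-2,1),\ldots,(k,k-1),(k,k)$. *)

theory Defs
  imports Main "HOL-Library.Disjoint_Sets"
begin

section \<open>Set partitions and their standard representation\<close>

datatype vertex = Unprimed nat | Primed nat

definition vertices :: "nat \<Rightarrow> vertex set" where
  "vertices k = Unprimed ` {1..k} \<union> Primed ` {1..k}"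

definition A :: "nat \<Rightarrow> vertex set set set" where
  "A k = {d. partition_on (vertices k) d}"

fun relabel :: "nat \<Rightarrow> vertex \<Rightarrow> nat" where
  "relabel k (Unprimed i) = i"
| "relabel k (Primed j) = 2 * k - j + 1"

definition std_rep :: "nat \<Rightarrow> vertex set set \<Rightarrow> nat set set" where
  "std_rep k d = (\<lambda>B. relabel k ` B) ` d"

definition edge :: "nat \<Rightarrow> vertex set set \<Rightarrow> nat \<Rightarrow> nat \<Rightarrow> bool" where
  "edge k d i j \<longleftrightarrow>
     i < j \<and> (\<exists>B \<in> std_rep k d. i \<in> B \<and> j \<in> B \<and> (\<forall>m. i < m \<and> m < j \<longrightarrow> m \<notin> B))"

definition edge_label :: "nat \<Rightarrow> nat \<Rightarrow> nat" where
  \<comment> \<open>label of an edge with right endpoint \<open>r\<close>\<close>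
  "edge_label k r = 2 * k + 1 - r"

section \<open>The insertion sequence\<close>

definition left_entry :: "nat \<Rightarrow> vertex set set \<Rightarrow> nat \<Rightarrow> nat option" where
  "left_entry k d j =
     (if \<exists>r. edge k d j r then Some (edge_label k (THE r. edge k d j r)) else None)"

definition right_entry :: "nat \<Rightarrow> vertex set set \<Rightarrow> nat \<Rightarrow> nat option" where
  "right_entry k d j = (if \<exists>i. edge k d i j then Some (edge_label k j) else None)"

text \<open>
  Half-integer indices are doubled throughout: \<open>ins_seq k d n\<close> is $E_{n/2}$, for \<open>1 \<le> n \<le> 4 * k\<close>.
  Thus $E_j$ is at the even index \<open>2 * j\<close> and $E_{j-1/2}$ is at the odd index \<open>2 * j - 1\<close>;
  the symbol $\emptyset$ is \<open>None\<close>.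
\<close>

definition ins_seq :: "nat \<Rightarrow> vertex set set \<Rightarrow> nat \<Rightarrow> nat option" where
  "ins_seq k d n =
     (if even n then left_entry k d (n div 2) else right_entry k d ((n + 1) div 2))"

section \<open>Partitions, tableaux, deletion and insertion\<close>

text \<open>
  An integer partition is the finitely supported function listing its parts, padded with zeros;
  rows are counted from 0, so that \<open>l i\<close> is the part $\lambda_{i+1}$. The pointwise order on such
  functions is containment of Young diagrams. A tableau is the list of its (nonempty) rows, and
  its boxes also have coordinates (row, column) counted from 0.
\<close>

type_synonym partition = "nat \<Rightarrow> nat"
type_synonym tableau = "nat list list"

definition empty_partition :: partition where
  "empty_partition = (\<lambda>_. 0)"

definition shape :: "tableau \<Rightarrow> partition" where
  "shape T = (\<lambda>i. if i < length T then length (T ! i) else 0)"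

definition is_box :: "tableau \<Rightarrow> nat \<times> nat \<Rightarrow> bool" where
  "is_box T = (\<lambda>(i, j). i < length T \<and> j < length (T ! i))"

definition entry :: "tableau \<Rightarrow> nat \<times> nat \<Rightarrow> nat" where
  "entry T = (\<lambda>(i, j). T ! i ! j)"

definition set_entry :: "tableau \<Rightarrow> nat \<times> nat \<Rightarrow> nat \<Rightarrow> tableau" where
  "set_entry T = (\<lambda>(i, j) x. T[i := (T ! i)[j := x]])"

definition exchange :: "tableau \<Rightarrow> nat \<times> nat \<Rightarrow> nat \<times> nat \<Rightarrow> tableau" where
  "exchange T p q = set_entry (set_entry T p (entry T q)) q (entry T p)"

definition delete_corner :: "tableau \<Rightarrow> nat \<Rightarrow> tableau" where
  \<comment> \<open>removes the last box of row \<open>i\<close>, and the row itself if it becomes empty\<close>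
  "delete_corner T i = filter (\<lambda>r. r \<noteq> []) (T[i := butlast (T ! i)])"

lemma map_length_exchange [simp]: "map length (exchange T p q) = map length T"
proof -
  have "map length (set_entry U r x) = map length U" for U r x
    by (cases r; cases "fst r < length U")
      (auto simp: set_entry_def map_update list_update_beyond
        intro: list_update_same_conv [THEN iffD2])
  then show ?thesis by (simp add: exchange_def)
qed

text \<open>
  \<open>(i, j)\<close> is the current box of the entry being deleted. The last branch is reached exactly when
  there is no box below and none to the right, i.e. when \<open>(i, j)\<close> is a corner.
\<close>

function jdt_slide :: "tableau \<Rightarrow> nat \<Rightarrow> nat \<Rightarrow> tableau" where
  "jdt_slide T i j =
     (if is_box T (i + 1, j) \<and> (is_box T (i, j + 1) \<longrightarrow> entry T (i + 1, j) < entry T (i, j + 1))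
      then jdt_slide (exchange T (i, j) (i + 1, j)) (i + 1) j
      else if is_box T (i, j + 1)
      then jdt_slide (exchange T (i, j) (i, j + 1)) i (j + 1)
      else delete_corner T i)"
  by pat_completeness auto

termination
proof (relation "measure (\<lambda>(T, i, j). (length T - i) + (sum_list (map length T) - j))",
    goal_cases)
  case 1
  then show ?case by simp
next
  case (2 T i j)
  have "length (exchange T (i, j) (i + 1, j)) = length T"
    using map_length_exchange by (metis length_map)
  with 2 show ?case by (auto simp: is_box_def)
next
  case (3 T i j)
  have *: "length (exchange T (i, j) (i, j + 1)) = length T"
    using map_length_exchange by (metis length_map)
  have "length (T ! i) \<le> sum_list (map length T)"
    using 3 by (intro member_le_sum_list) (auto simp: is_box_def)
  with 3 * show ?case by (auto simp: is_box_def)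
qed

declare jdt_slide.simps [simp del]

definition jdt_delete :: "nat \<Rightarrow> tableau \<Rightarrow> tableau" where
  \<comment> \<open>The entries of a tableau are distinct; an entry that does not occur is never deleted below.\<close>
  "jdt_delete x T =
     (if \<exists>p. is_box T p \<and> entry T p = x
      then (let (i, j) = (THE p. is_box T p \<and> entry T p = x) in jdt_slide T i j)
      else T)"

fun rsk_insert :: "nat \<Rightarrow> tableau \<Rightarrow> tableau" where
  "rsk_insert x [] = [[x]]"
| "rsk_insert x (R # Rs) =
     (if \<exists>y \<in> set R. x < y
      then (let y = Min {y \<in> set R. x < y}
            in map (\<lambda>z. if z = y then x else z) R # rsk_insert y Rs)
      else (R @ [x]) # Rs)"

section \<open>The insertion map\<close>

text \<open>\<open>ins_tableau k d n\<close> is $T^{(n/2)}$ and \<open>ins_shape k d n\<close> is $\lambda^{(n/2)}$.\<close>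

fun ins_tableau :: "nat \<Rightarrow> vertex set set \<Rightarrow> nat \<Rightarrow> tableau" where
  "ins_tableau k d 0 = []"
| "ins_tableau k d (Suc n) =
     (case ins_seq k d (Suc n) of
        None \<Rightarrow> ins_tableau k d n
      | Some a \<Rightarrow>
          if odd (Suc n) then jdt_delete a (ins_tableau k d n)
          else rsk_insert a (ins_tableau k d n))"

definition ins_shape :: "nat \<Rightarrow> vertex set set \<Rightarrow> nat \<Rightarrow> partition" where
  "ins_shape k d n = shape (ins_tableau k d n)"

definition insertion_map :: "nat \<Rightarrow> vertex set set \<Rightarrow> partition list \<times> partition list" where
  \<comment> \<open>the pair $(P, Q)$\<close>
  "insertion_map k d =
     (map (\<lambda>n. ins_shape k d (4 * k - n)) [0..<2 * k + 1],
      map (\<lambda>n. ins_shape k d n) [0..<2 * k + 1])"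

section \<open>The growth diagram\<close>

definition has_X :: "nat \<Rightarrow> vertex set set \<Rightarrow> nat \<Rightarrow> nat \<Rightarrow> bool" where
  \<comment> \<open>column \<open>i\<close>, row \<open>j\<close>\<close>
  "has_X k d i j \<longleftrightarrow> (\<exists>r. edge k d i r \<and> edge_label k r = j)"

definition add_box :: "nat \<Rightarrow> partition \<Rightarrow> partition" where
  "add_box i l = l(i := l i + 1)"

text \<open>
  The three branches with \<open>mu = nu\<close> are (L2) and the two cases of (L3); in a growth diagram
  the lower-left label is always contained in its neighbours, so that the
  negation of \<open>lam < mu\<close> means \<open>lam = mu\<close>.
\<close>

definition local_rule :: "partition \<Rightarrow> partition \<Rightarrow> partition \<Rightarrow> bool \<Rightarrow> partition" where
  "local_rule lam mu nu X =
     (if mu \<noteq> nu then (\<lambda>i. max (mu i) (nu i))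
      else if lam < mu then add_box ((THE i. mu = add_box i lam) + 1) mu
      else if X then add_box 0 lam
      else lam)"

text \<open>
  \<open>growth k d a b\<close> is the label of the point \<open>(a, b)\<close> in the growth diagram of \<open>d\<close>. The recursion
  makes sense for all \<open>a\<close> and \<open>b\<close>, but only the points with \<open>a + b \<le> 2 * k\<close>
  belong to the diagram; their labels do not depend on any other points.
\<close>

fun growth :: "nat \<Rightarrow> vertex set set \<Rightarrow> nat \<Rightarrow> nat \<Rightarrow> partition" where
  "growth k d 0 b = empty_partition"
| "growth k d (Suc a) 0 = empty_partition"
| "growth k d (Suc a) (Suc b) =
     local_rule (growth k d a b) (growth k d (Suc a) b) (growth k d a (Suc b))
       (has_X k d (Suc a) (Suc b))"

text \<open>
  The \<open>n\<close>-th points, \<open>0 \<le> n \<le> 2 * k\<close>, of the staircase paths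
  $(0,2k),(0,2k-1),(1,2k-1),\ldots,(k-1,k),(k,k)$ and
  $(2k,0),(2k-1,0),(2k-1,1),\ldots,(k,k-1),(k,k)$.
\<close>

definition Q_path :: "nat \<Rightarrow> nat \<Rightarrow> nat \<times> nat" where
  "Q_path k n = (n div 2, 2 * k - (n + 1) div 2)"

definition P_path :: "nat \<Rightarrow> nat \<Rightarrow> nat \<times> nat" where
  "P_path k n = (2 * k - (n + 1) div 2, n div 2)"

definition growth_Q :: "nat \<Rightarrow> vertex set set \<Rightarrow> partition list" where
  "growth_Q k d = map (\<lambda>n. case Q_path k n of (a, b) \<Rightarrow> growth k d a b) [0..<2 * k + 1]"

definition growth_P :: "nat \<Rightarrow> vertex set set \<Rightarrow> partition list" where
  "growth_P k d = map (\<lambda>n. case P_path k n of (a, b) \<Rightarrow> growth k d a b) [0..<2 * k + 1]"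

end

theory Submission
  imports Defs
begin

text \<open>
  The labels of the edges are deleted in decreasing order, so the entry being deleted is always the
  largest one in the tableau and sits in a corner: jeu de taquin never slides. Hence the tableaux of
  the insertion map are the row insertion tableaux \<open>T(a, b)\<close> of the word read off the first \<open>a\<close>
  columns of the growth diagram, restricted to the letters \<open>\<le> b\<close>, for the points \<open>(a, b)\<close> of the
  staircase. Passing from \<open>b\<close> to \<open>b + 1\<close> either changes nothing or appends the new maximum
  \<open>b + 1\<close> to some row \<open>r\<close>. Inserting a smaller letter that adds a box in row \<open>s\<close> leaves the
  maximum in place if \<open>r \<noteq> s\<close> and bumps it from row \<open>r\<close> to the end of row \<open>r + 1\<close> if
  \<open>r = s\<close>; these are the local rules (L1) and (L2). That the shapes are partitions follows from
  the local rules, so the order conditions on tableaux play no role.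
\<close>

section \<open>Appending a maximal entry\<close>

text \<open>The index names the row of the new box only for \<open>r \<le> length T\<close>; at
  equality a new row is opened, and beyond it the first clause ignores the excess.\<close>

fun append_at :: "nat \<Rightarrow> nat \<Rightarrow> tableau \<Rightarrow> tableau" where
  "append_at b r [] = [[b]]"
| "append_at b 0 (R # Rs) = (R @ [b]) # Rs"
| "append_at b (Suc r) (R # Rs) = R # append_at b r Rs"

lemma shape_Nil [simp]: "shape [] = empty_partition"
  by (simp add: shape_def empty_partition_def)

lemma shape_Cons: "shape (R # Rs) = case_nat (length R) (shape Rs)"
  by (rule ext) (simp add: shape_def split: nat.split)

lemma add_box_0_case_nat [simp]: "add_box 0 (case_nat n l) = case_nat (Suc n) l"
  by (rule ext) (simp add: add_box_def split: nat.split)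

lemma add_box_Suc_case_nat [simp]: "add_box (Suc i) (case_nat n l) = case_nat n (add_box i l)"
  by (rule ext) (simp add: add_box_def split: nat.split)

lemma add_box_eq_iff: "add_box i l = add_box j l \<longleftrightarrow> i = j"
  by (auto simp: add_box_def fun_eq_iff split: if_splits)

lemma less_add_box: "l < add_box i l"
  by (auto simp: add_box_def less_fun_def le_fun_def intro: exI [of _ i])

lemma antimono_add_box_0: "antimono l \<Longrightarrow> antimono (add_box 0 l)"
  by (auto simp: antimono_iff_le_Suc add_box_def le_SucI)

text \<open>If \<open>r = s\<close>, the box added in row \<open>s\<close> makes room for one in row
  \<open>s + 1\<close>, which was no longer than row \<open>s\<close>. If
  \<open>r \<noteq> s\<close>, boxes that fit separately fit together.\<close>

lemma antimono_add_box_add_box: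
  assumes "antimono l" "antimono (add_box s l)" "antimono (add_box r l)"
  shows "antimono (add_box (if r = s then Suc r else r) (add_box s l))"
  unfolding antimono_iff_le_Suc
proof
  fix n
  have "l (Suc n) \<le> l n" "add_box s l (Suc n) \<le> add_box s l n" "add_box r l (Suc n) \<le> add_box r l n"
    using assms unfolding antimono_iff_le_Suc by blast+
  then show "add_box (if r = s then Suc r else r) (add_box s l) (Suc n) \<le>
      add_box (if r = s then Suc r else r) (add_box s l) n"
    by (cases "r = s") (auto simp: add_box_def split: if_splits)
qed

lemma add_box_0_empty: "add_box 0 empty_partition = case_nat (Suc 0) empty_partition"
  by (rule ext) (simp add: add_box_def empty_partition_def split: nat.split)

lemma shape_append_at:
  "r \<le> length T \<Longrightarrow> shape (append_at b r T) = add_box r (shape T)"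
  by (induction b r T rule: append_at.induct) (simp_all add: shape_Cons add_box_0_empty)

lemma append_at_conv:
  "r \<le> length T \<Longrightarrow>
    append_at b r T = (if r < length T then T[r := T ! r @ [b]] else T @ [[b]])"
  by (induction b r T rule: append_at.induct) auto

lemma rsk_insert_max:
  assumes "\<forall>y \<in> set (concat T). y < b"
  shows "rsk_insert b T = append_at b 0 T"
  using assms by (cases T) (auto dest: less_asym)

lemma set_concat_rsk_insert: "set (concat (rsk_insert x T)) = insert x (set (concat T))"
proof (induction x T rule: rsk_insert.induct)
  case (2 x R Rs)
  show ?case
  proof (cases "\<exists>y \<in> set R. x < y")
    case True
    define y where "y = Min {y \<in> set R. x < y}"
    have "y \<in> {y \<in> set R. x < y}"
      unfolding y_def using True by (intro Min_in) auto
    then show ?thesis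
      using True 2 by (auto simp: Let_def simp flip: y_def)
  qed auto
qed simp

lemma Nil_notin_rsk_insert: "[] \<notin> set T \<Longrightarrow> [] \<notin> set (rsk_insert x T)"
  by (induction x T rule: rsk_insert.induct) (auto simp: Let_def)

text \<open>The row \<open>s\<close> in which the insertion of \<open>x\<close> ends depends on
  \<open>x\<close> and \<open>T\<close> alone. In the rows above \<open>s\<close> some smaller entry
  is bumped in preference to \<open>b\<close>; in row \<open>s\<close> nothing but \<open>b\<close>
  can be bumped, and it then goes to the end of the next row.\<close>

lemma rsk_insert_append_at:
  assumes "\<forall>y \<in> set (concat T). y < b" and "x < b"
  shows "\<exists>s. shape (rsk_insert x T) = add_box s (shape T) \<and>
    (\<forall>r \<le> length T.
      (if r = s then Suc r else r) \<le> length (rsk_insert x T) \<and>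
      rsk_insert x (append_at b r T) = append_at b (if r = s then Suc r else r) (rsk_insert x T))"
  using assms
proof (induction x T rule: rsk_insert.induct)
  case (1 x)
  \<comment> \<open>Only \<open>r = 0\<close> arises here: \<open>x\<close> bumps \<open>b\<close>
    out of the row \<open>[b]\<close> into a second row.\<close>
  then have "{y. y = b \<and> x < y} = {b}"
    by auto
  with 1 show ?case
    by (intro exI [of _ 0]) (auto simp: shape_Cons add_box_0_empty)
next
  case (2 x R Rs)
  show ?case
  proof (cases "\<exists>y \<in> set R. x < y")
    case True
    define y where "y = Min {y \<in> set R. x < y}"
    have y: "y \<in> {y \<in> set R. x < y}"
      unfolding y_def using True by (intro Min_in) auto
    \<comment> \<open>A candidate smaller than \<open>b\<close> exists, so \<open>b\<close> does not
      affect the minimum.\<close>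
    have *: "{y \<in> set (R @ [b]). x < y} = insert b {y \<in> set R. x < y}"
      using 2 by auto
    have "y < b"
      using y 2 by auto
    then have y': "Min {y \<in> set (R @ [b]). x < y} = y"
      unfolding * using y by (subst Min_insert) (auto simp: min_def simp flip: y_def)
    let ?R = "map (\<lambda>z. if z = y then x else z) R"
    have ins: "rsk_insert x (R # Us) = ?R # rsk_insert y Us" for Us
      using True by (simp add: y_def Let_def)
    have ins': "rsk_insert x ((R @ [b]) # Rs) = (?R @ [b]) # rsk_insert y Rs"
      unfolding rsk_insert.simps(2) y' Let_def using True y 2 by auto
    have "\<forall>z \<in> set (concat Rs). z < b" "y < b"
      using y 2 by auto
    from 2(1)[OF True y_def this] obtain s where
      s: "shape (rsk_insert y Rs) = add_box s (shape Rs)"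
        "\<And>r. r \<le> length Rs \<Longrightarrow> (if r = s then Suc r else r) \<le> length (rsk_insert y Rs)"
        "\<And>r. r \<le> length Rs \<Longrightarrow> rsk_insert y (append_at b r Rs) =
          append_at b (if r = s then Suc r else r) (rsk_insert y Rs)"
      by blast
    have "(if r = Suc s then Suc r else r) \<le> length (rsk_insert x (R # Rs)) \<and>
        rsk_insert x (append_at b r (R # Rs)) =
          append_at b (if r = Suc s then Suc r else r) (rsk_insert x (R # Rs))"
      if "r \<le> length (R # Rs)" for r
    proof (cases r)
      case 0
      then show ?thesis by (simp add: ins ins' del: rsk_insert.simps)
    next
      case (Suc r')
      then show ?thesis
        using that s(2,3)[of r'] by (auto simp: ins simp del: rsk_insert.simps)
    qed
    then show ?thesis
      using s(1) by (intro exI [of _ "Suc s"]) (simp add: ins shape_Cons del: rsk_insert.simps)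
  next
    case False
    have *: "{y \<in> set (R @ [b]). x < y} = {b}"
      using False 2 by auto
    have "map (\<lambda>z. if z = b then x else z) R = R"
      using 2 by (intro map_idI) auto
    then have ins: "rsk_insert x ((R @ [b]) # Rs) = (R @ [x]) # append_at b 0 Rs"
      unfolding rsk_insert.simps(2) * using 2 by (simp add: rsk_insert_max)
    have insC: "rsk_insert x (R # Us) = (R @ [x]) # Us" for Us
      using False by simp
    have "(if r = 0 then Suc r else r) \<le> length (rsk_insert x (R # Rs)) \<and>
        rsk_insert x (append_at b r (R # Rs)) =
          append_at b (if r = 0 then Suc r else r) (rsk_insert x (R # Rs))"
      if "r \<le> length (R # Rs)" for r
      using that by (cases r) (simp_all add: ins insC del: rsk_insert.simps)
    then show ?thesis
      by (intro exI [of _ 0]) (simp add: insC shape_Cons del: rsk_insert.simps)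
  qed
qed

text \<open>The only occurrence of \<open>b\<close> is the appended box. As the row lengths of
  \<open>T\<close> decrease weakly, nothing lies below that box, so it is a corner and the slide
  stops at once.\<close>

lemma jdt_delete_append_at:
  assumes r: "r \<le> length T" and b: "b \<notin> set (concat T)" and ne: "[] \<notin> set T"
    and anti: "antimono (shape T)"
  shows "jdt_delete b (append_at b r T) = T"
proof -
  let ?U = "append_at b r T"
  let ?c = "shape T r"
  note U = append_at_conv[OF r, of b]
  have shU: "shape ?U = add_box r (shape T)"
    using r by (rule shape_append_at)
  have box: "is_box ?U (i, j) \<longleftrightarrow> j < add_box r (shape T) i" for i j
    unfolding shU [symmetric] by (simp add: is_box_def shape_def)
  have occ: "is_box ?U p \<and> entry ?U p = b \<longleftrightarrow> p = (r, ?c)" for p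
  proof (cases p)
    case (Pair i j)
    have "entry ?U (i, j) \<noteq> b" if "j < shape T i"
    proof -
      from that have ij: "i < length T" "j < length (T ! i)"
        by (auto simp: shape_def split: if_splits)
      then have "T ! i ! j \<in> set (concat T)"
        unfolding set_concat by (metis UN_I nth_mem)
      moreover have "entry ?U (i, j) = T ! i ! j"
        using ij r by (auto simp: U entry_def nth_append nth_list_update)
      ultimately show ?thesis using b by metis
    qed
    moreover have "entry ?U (r, ?c) = b"
      using r by (auto simp: U entry_def nth_append shape_def)
    ultimately show ?thesis
      by (auto simp: Pair box add_box_def less_Suc_eq split: if_splits)
  qed
  have below: "\<not> is_box ?U (r + 1, ?c)"
  proof -
    have "shape T (Suc r) \<le> ?c"
      using anti by (rule antimonoD) simp
    then show ?thesis by (simp add: box add_box_def)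
  qed
  have right: "\<not> is_box ?U (r, ?c + 1)"
    by (simp add: box add_box_def)
  have "jdt_delete b ?U = jdt_slide ?U r ?c"
    by (simp add: jdt_delete_def occ)
  also have "\<dots> = delete_corner ?U r"
    using below right by (subst jdt_slide.simps) simp
  \<comment> \<open>If \<open>r = length T\<close>, the filter drops the emptied row; otherwise it
    removes nothing, since \<open>T\<close> has no empty row.\<close>
  also have "\<dots> = T"
    using r ne by (auto simp: delete_corner_def U intro!: filter_True)
  finally show ?thesis .
qed

section \<open>Insertion tableaux of restricted words\<close>

text \<open>
  A partial permutation is given by \<open>w :: nat \<Rightarrow> nat option\<close>, where \<open>w i = Some j\<close> means that
  column \<open>i\<close> has its X in row \<open>j\<close>.
\<close>

fun insertion_tableau :: "(nat \<Rightarrow> nat option) \<Rightarrow> nat \<Rightarrow> nat \<Rightarrow> tableau" where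
  "insertion_tableau w 0 b = []"
| "insertion_tableau w (Suc a) b =
     (case w (Suc a) of
        None \<Rightarrow> insertion_tableau w a b
      | Some x \<Rightarrow> if x \<le> b then rsk_insert x (insertion_tableau w a b) else insertion_tableau w a b)"

lemma insertion_tableau_le: "x \<in> set (concat (insertion_tableau w a b)) \<Longrightarrow> x \<le> b"
  by (induction a)
    (auto simp del: set_concat simp: set_concat_rsk_insert split: option.splits if_splits)

lemma Nil_notin_insertion_tableau: "[] \<notin> set (insertion_tableau w a b)"
  by (induction a) (auto simp: Nil_notin_rsk_insert split: option.splits)

lemma insertion_tableau_Suc_absent:
  assumes "\<And>i. i \<in> {1..a} \<Longrightarrow> w i \<noteq> Some (Suc b)"
  shows "insertion_tableau w a (Suc b) = insertion_tableau w a b"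
  using assms
proof (induction a)
  case (Suc a)
  then have "insertion_tableau w a (Suc b) = insertion_tableau w a b" "w (Suc a) \<noteq> Some (Suc b)"
    by simp_all
  then show ?case
    by (auto split: option.split)
qed simp

section \<open>Growth diagrams of partial permutations\<close>

locale partial_perm =
  fixes w :: "nat \<Rightarrow> nat option"
  assumes w_pos: "w i = Some x \<Longrightarrow> 0 < x"
    and w_inj: "w i = Some x \<Longrightarrow> w j = Some x \<Longrightarrow> i = j"
begin

abbreviation "T \<equiv> insertion_tableau w"

lemma T_0_right: "T a 0 = []"
  by (induction a) (auto dest: w_pos split: option.split)

lemma T_less: "\<forall>y \<in> set (concat (T a b)). y < Suc b"
  using insertion_tableau_le le_imp_less_Suc by blast

text \<open>Column \<open>i\<close> puts the new maximum at the end of the first row. By injectivity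
  \<open>Suc b\<close> occurs in no other column, so each later column either changes neither
  tableau or inserts a smaller letter into both, which moves the maximum as in
  \<open>rsk_insert_append_at\<close>.\<close>

lemma T_Suc_present:
  assumes "i \<in> {1..a}" and "w i = Some (Suc b)"
  shows "\<exists>r \<le> length (T a b). T a (Suc b) = append_at (Suc b) r (T a b)"
  using assms(1)
proof (induction a)
  case (Suc a)
  show ?case
  proof (cases "i = Suc a")
    case True
    have "T a (Suc b) = T a b"
      using True assms(2) by (intro insertion_tableau_Suc_absent) (auto dest: w_inj)
    then show ?thesis
      using True assms(2) rsk_insert_max [OF T_less] by auto
  next
    case False
    then obtain r where r: "r \<le> length (T a b)" "T a (Suc b) = append_at (Suc b) r (T a b)"
      using Suc by auto
    have ne: "w (Suc a) \<noteq> Some (Suc b)"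
      using False assms(2) w_inj by blast
    show ?thesis
    proof (cases "\<exists>x. w (Suc a) = Some x \<and> x \<le> b")
      case True
      then obtain x where x: "w (Suc a) = Some x" "x \<le> b"
        by blast
      then have "x < Suc b"
        by simp
      from rsk_insert_append_at [OF T_less this] r(1) show ?thesis
        unfolding insertion_tableau.simps using x r(2) by auto
    next
      case False
      with ne have "T (Suc a) (Suc b) = T a (Suc b)" "T (Suc a) b = T a b"
        by (auto split: option.split)
      with r show ?thesis by auto
    qed
  qed
qed simp

text \<open>The cases record where the X of column \<open>Suc a\<close> and that of row
  \<open>Suc b\<close> lie relative to the cell: column X not at or below it, row X not at or left
  of it, X in the cell, or one X strictly below and one strictly left. Both the local rules and the
  monotonicity of shapes are read off from them.\<close>

lemma T_cell_cases:
  obtains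
    (no_column) "w (Suc a) \<noteq> Some (Suc b)" "T (Suc a) b = T a b" "T (Suc a) (Suc b) = T a (Suc b)"
      "T a (Suc b) = T a b \<or> (\<exists>r. shape (T a (Suc b)) = add_box r (shape (T a b)))"
  | (no_row) s where "w (Suc a) \<noteq> Some (Suc b)" "T a (Suc b) = T a b"
      "T (Suc a) (Suc b) = T (Suc a) b" "shape (T (Suc a) b) = add_box s (shape (T a b))"
  | (X) "w (Suc a) = Some (Suc b)" "T (Suc a) b = T a b" "T a (Suc b) = T a b"
      "shape (T (Suc a) (Suc b)) = add_box 0 (shape (T a b))"
  | (both) s r where "w (Suc a) \<noteq> Some (Suc b)" "shape (T (Suc a) b) = add_box s (shape (T a b))"
      "shape (T a (Suc b)) = add_box r (shape (T a b))"
      "shape (T (Suc a) (Suc b)) = add_box (if r = s then Suc r else r) (add_box s (shape (T a b)))"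
proof -
  have row: "T a (Suc b) = T a b \<or>
      (\<exists>r \<le> length (T a b). T a (Suc b) = append_at (Suc b) r (T a b))"
    using insertion_tableau_Suc_absent T_Suc_present by blast
  consider (x) x where "w (Suc a) = Some x" "x \<le> b" | (X) "w (Suc a) = Some (Suc b)"
    | (none) "w (Suc a) \<noteq> Some (Suc b)" "\<nexists>x. w (Suc a) = Some x \<and> x \<le> b"
    by blast
  then show thesis
  proof cases
    case x
    then have ne: "w (Suc a) \<noteq> Some (Suc b)" "x < Suc b"
      by auto
    have ins: "T (Suc a) b = rsk_insert x (T a b)" "T (Suc a) (Suc b) = rsk_insert x (T a (Suc b))"
      using x by simp_all
    obtain s where s: "shape (rsk_insert x (T a b)) = add_box s (shape (T a b))"
      "\<And>r. r \<le> length (T a b) \<Longrightarrow> (if r = s then Suc r else r) \<le> length (rsk_insert x (T a b))"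
      "\<And>r. r \<le> length (T a b) \<Longrightarrow> rsk_insert x (append_at (Suc b) r (T a b)) =
         append_at (Suc b) (if r = s then Suc r else r) (rsk_insert x (T a b))"
      using rsk_insert_append_at [OF T_less ne(2)] by blast
    show thesis
    proof (cases "T a (Suc b) = T a b")
      case True
      with ne(1) show thesis
        by (rule no_row) (use ins s(1) True in simp_all)
    next
      case False
      with row obtain r where r: "r \<le> length (T a b)" "T a (Suc b) = append_at (Suc b) r (T a b)"
        by blast
      show thesis
        by (rule both [OF ne(1)])
          (use s(1) r s(2,3) [OF r(1)] in \<open>simp_all only: ins shape_append_at\<close>)
    qed
  next
    case X
    have "T a (Suc b) = T a b"
      using X by (intro insertion_tableau_Suc_absent) (auto dest: w_inj)
    with X show thesis
      by (intro that(3)) (simp_all add: rsk_insert_max [OF T_less] shape_append_at)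
  next
    case none
    then have "T (Suc a) b = T a b" "T (Suc a) (Suc b) = T a (Suc b)"
      by (auto split: option.split)
    then show thesis
      using none row shape_append_at by (intro no_column) auto
  qed
qed

text \<open>Cases \<open>no_column\<close> and \<open>no_row\<close> fall under (L1), or under (L3)
  without X if all shapes agree. Case \<open>X\<close> is (L3) with X; case \<open>both\<close> is
  (L1) for \<open>r \<noteq> s\<close> and (L2) for \<open>r = s\<close>.\<close>

lemma shape_T_Suc_Suc:
  "shape (T (Suc a) (Suc b)) = local_rule (shape (T a b)) (shape (T (Suc a) b)) (shape (T a (Suc b)))
     (w (Suc a) = Some (Suc b))"
proof (cases rule: T_cell_cases [of a b])
  case no_column
  have "(\<lambda>i. max (l i) (add_box r l i)) = add_box r l" for l r
    by (auto simp: add_box_def)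
  with no_column show ?thesis
    by (auto simp: local_rule_def)
next
  case (no_row s)
  have "(\<lambda>i. max (add_box r l i) (l i)) = add_box r l" for l r
    by (auto simp: add_box_def)
  with no_row show ?thesis
    by (auto simp: local_rule_def)
next
  case X
  then show ?thesis
    by (simp add: local_rule_def)
next
  case (both s r)
  have "(\<lambda>i. max (add_box s l i) (add_box r l i)) = add_box r (add_box s l)" if "r \<noteq> s" for l
    using that by (auto simp: add_box_def)
  with both show ?thesis
    by (simp add: local_rule_def add_box_eq_iff less_add_box)
qed

text \<open>If the other three corners of a cell carry partitions, so does the upper right one,
  whichever case applies. This is what makes the maximum sit in a corner.\<close>

lemma antimono_shape_T: "antimono (shape (T a b))"
proof (induction a arbitrary: b)
  case 0
  then show ?case by (simp add: empty_partition_def monotone_def)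
next
  case (Suc a b)
  show ?case
  proof (induction b)
    case 0
    then show ?case
      by (simp add: T_0_right empty_partition_def monotone_def del: insertion_tableau.simps)
  next
    case (Suc b)
    note IH = Suc \<open>antimono (shape (T a b))\<close> \<open>antimono (shape (T a (Suc b)))\<close>
    show ?case
    proof (cases rule: T_cell_cases [of a b])
      case X
      with IH(2) show ?thesis
        using antimono_add_box_0 by metis
    next
      case (both s r)
      with IH show ?thesis
        using antimono_add_box_add_box by metis
    qed (use IH in simp_all)
  qed
qed

lemma jdt_delete_T:
  assumes "i \<in> {1..a}" and "w i = Some (Suc b)"
  shows "jdt_delete (Suc b) (T a (Suc b)) = T a b"
proof -
  obtain r where "r \<le> length (T a b)" "T a (Suc b) = append_at (Suc b) r (T a b)"
    using T_Suc_present [OF assms] by blast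
  moreover have "Suc b \<notin> set (concat (T a b))"
    using T_less by blast
  ultimately show ?thesis
    by (simp only: jdt_delete_append_at Nil_notin_insertion_tableau antimono_shape_T simp_thms)
qed

end

section \<open>The partial permutation of a set partition\<close>

lemma partition_on_std_rep:
  assumes "d \<in> A k"
  shows "partition_on {1..2 * k} (std_rep k d)"
proof -
  have d: "partition_on (vertices k) d"
    using assms by (simp add: A_def)
  have "inj_on (relabel k) (vertices k)"
    by (auto simp: inj_on_def vertices_def)
  note part = partition_on_inj_image [OF d this]
  have "relabel k ` vertices k = {1..2 * k}"
  proof (intro equalityI subsetI)
    fix i assume i: "i \<in> {1..2 * k}"
    show "i \<in> relabel k ` vertices k"
    proof (cases "i \<le> k")
      case True
      then show ?thesis
        using i by (intro image_eqI [of _ _ "Unprimed i"]) (auto simp: vertices_def)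
    next
      case False
      then show ?thesis
        \<comment> \<open>The witness solves \<open>2 * k - j + 1 = i\<close> for
          \<open>j\<close>.\<close>
        using i by (intro image_eqI [of _ _ "Primed (2 * k + 1 - i)"])
          (auto simp: vertices_def intro!: UnI2 imageI)
    qed
  qed (auto simp: vertices_def)
  moreover have "{} \<notin> (`) (relabel k) ` d"
    using d by (auto simp: partition_on_def)
  ultimately show ?thesis
    using part by (simp add: std_rep_def)
qed

text \<open>Blocks are disjoint and edges join consecutive elements of a block, so each endpoint
  determines the other.\<close>

lemma
  assumes d: "d \<in> A k" and e: "edge k d i r"
  shows edge_bounds: "1 \<le> i" "i < r" "r \<le> 2 * k"
    and edge_right_unique: "edge k d i r' \<Longrightarrow> r = r'"
    and edge_left_unique: "edge k d i' r \<Longrightarrow> i = i'"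
proof -
  note part = partition_on_std_rep [OF d]
  have block_unique: "B = B'" if "B \<in> std_rep k d" "B' \<in> std_rep k d" "x \<in> B" "x \<in> B'" for x B B'
    using part that by (auto simp: partition_on_def disjoint_def)
  obtain B where B: "i < r" "B \<in> std_rep k d" "i \<in> B" "r \<in> B" "\<forall>m. i < m \<and> m < r \<longrightarrow> m \<notin> B"
    using e by (auto simp: edge_def)
  have "B \<subseteq> {1..2 * k}"
    using part B(2) by (auto simp: partition_on_def)
  then show "1 \<le> i" "i < r" "r \<le> 2 * k"
    using B by auto
  show "r = r'" if "edge k d i r'"
    using that B block_unique unfolding edge_def by (metis linorder_neqE_nat)
  show "i = i'" if "edge k d i' r"
    using that B block_unique unfolding edge_def by (metis linorder_neqE_nat)
qed

lemma left_entry_eq_Some_iff: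
  assumes "d \<in> A k"
  shows "left_entry k d i = Some x \<longleftrightarrow> (\<exists>r. edge k d i r \<and> x = edge_label k r)"
proof -
  have "(THE r. edge k d i r) = r" if "edge k d i r" for r
    using that edge_right_unique [OF assms] by blast
  then show ?thesis
    by (auto simp: left_entry_def)
qed

text \<open>Right endpoints are at most \<open>2 * k\<close>, so labels are positive and determine
  the right endpoint, hence also the left one.\<close>

lemma partial_perm_left_entry:
  assumes "d \<in> A k"
  shows "partial_perm (left_entry k d)"
proof
  fix i j x
  assume "left_entry k d i = Some x"
  then obtain r where r: "edge k d i r" "x = edge_label k r"
    by (auto simp: left_entry_eq_Some_iff [OF assms])
  with edge_bounds [OF assms r(1)] show "0 < x"
    by (simp add: edge_label_def)
  assume "left_entry k d j = Some x"
  then obtain r' where r': "edge k d j r'" "x = edge_label k r'"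
    by (auto simp: left_entry_eq_Some_iff [OF assms])
  have "r = r'"
    using r(2) r'(2) edge_bounds [OF assms r(1)] edge_bounds [OF assms r'(1)]
    by (simp add: edge_label_def)
  with r r' show "i = j"
    using edge_left_unique [OF assms] by blast
qed

section \<open>Growth labels and insertion tableaux along the staircase\<close>

lemma growth_eq_shape:
  assumes d: "d \<in> A k"
  shows "growth k d a b = shape (insertion_tableau (left_entry k d) a b)"
proof -
  interpret partial_perm "left_entry k d"
    using d by (rule partial_perm_left_entry)
  have X: "has_X k d i j \<longleftrightarrow> left_entry k d i = Some j" for i j
    by (auto simp: has_X_def left_entry_eq_Some_iff [OF d])
  show ?thesis
  proof (induction a arbitrary: b)
    case (Suc a)
    show ?case
      by (induction b) (simp_all add: X Suc T_0_right shape_T_Suc_Suc del: insertion_tableau.simps)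
  qed simp
qed

text \<open>The insertion map walks the whole staircase from \<open>(0, 2 * k)\<close> to
  \<open>(2 * k, 0)\<close>: odd steps delete and go down one row, even steps insert and go right
  one column.\<close>

lemma ins_tableau_eq:
  assumes d: "d \<in> A k" and "n \<le> 4 * k"
  shows "ins_tableau k d n = insertion_tableau (left_entry k d) (n div 2) (2 * k - (n + 1) div 2)"
  using assms(2)
proof (induction n)
  case (Suc n)
  interpret partial_perm "left_entry k d"
    using d by (rule partial_perm_left_entry)
  show ?case
  proof (cases "even n")
    case True
    then obtain j where n: "n = 2 * j"
      by blast
    define b where "b = 2 * k - Suc j"
    have b: "2 * k - j = Suc b" "edge_label k (Suc j) = Suc b"
      using Suc.prems by (auto simp: n b_def edge_label_def)
    have IH: "ins_tableau k d n = T j (Suc b)"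
      using Suc by (simp add: n b)
    have "ins_tableau k d (Suc n) = T j b"
    proof (cases "\<exists>i. edge k d i (Suc j)")
      case True
      then obtain i where e: "edge k d i (Suc j)"
        by blast
      then have "i \<in> {1..j}" "left_entry k d i = Some (Suc b)"
        using edge_bounds [OF d e] b by (auto simp: left_entry_eq_Some_iff [OF d])
      then show ?thesis
        using e by (auto simp: ins_seq_def right_entry_def n b IH [unfolded n] jdt_delete_T)
    next
      case False
      \<comment> \<open>Only an edge ending at vertex \<open>Suc j\<close> could have the label
        \<open>Suc b\<close>.\<close>
      have "T j (Suc b) = T j b"
      proof (rule insertion_tableau_Suc_absent)
        fix i
        show "left_entry k d i \<noteq> Some (Suc b)"
        proof
          assume "left_entry k d i = Some (Suc b)"
          then obtain r where r: "edge k d i r" "Suc b = edge_label k r"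
            by (auto simp: left_entry_eq_Some_iff [OF d])
          then have "r = Suc j"
            using edge_bounds [OF d r(1)] b by (simp add: edge_label_def)
          with r False show False by blast
        qed
      qed
      then show ?thesis
        using False by (simp add: ins_seq_def right_entry_def n IH [unfolded n])
    qed
    then show ?thesis
      by (simp add: n b_def)
  next
    case False
    then obtain j where n: "n = 2 * j + 1"
      using oddE by blast
    define b where "b = 2 * k - Suc j"
    have IH: "ins_tableau k d n = T j b"
      using Suc by (simp add: n b_def)
    \<comment> \<open>The right endpoint is at least \<open>j + 2\<close>, so its label survives the
      restriction to letters up to \<open>b\<close>.\<close>
    have "x \<le> b" if "left_entry k d (Suc j) = Some x" for x
      using that edge_bounds [OF d, of "Suc j"]
      by (fastforce simp: left_entry_eq_Some_iff [OF d] edge_label_def b_def)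
    moreover have "ins_tableau k d (Suc n) = (case left_entry k d (Suc j) of
        None \<Rightarrow> ins_tableau k d n | Some x \<Rightarrow> rsk_insert x (ins_tableau k d n))"
      using False by (simp add: ins_seq_def n [THEN arg_cong, of "\<lambda>n. Suc n div 2"]
          cong: option.case_cong)
    ultimately have "ins_tableau k d (Suc n) = T (Suc j) b"
      by (auto simp: IH split: option.split)
    then show ?thesis
      by (simp add: n b_def)
  qed
qed simp

theorem theorem5p5:
  fixes k :: nat and d :: "vertex set set" and P Q :: "partition list"
  assumes "k \<ge> 1"
    and "d \<in> A k"
    and "insertion_map k d = (P, Q)"
  shows "growth_P k d = P \<and> growth_Q k d = Q"
proof -
  have ins: "ins_shape k d n = growth k d (n div 2) (2 * k - (n + 1) div 2)" if "n \<le> 4 * k" for n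
    using that assms(2) by (simp add: ins_shape_def ins_tableau_eq growth_eq_shape)
  have "ins_shape k d (4 * k - n) = (case P_path k n of (a, b) \<Rightarrow> growth k d a b)"
    if "n \<le> 2 * k" for n
  proof -
    \<comment> \<open>Walking back \<open>n\<close> steps from the end \<open>(2 * k, 0)\<close> of
      the staircase reaches \<open>P_path k n\<close>.\<close>
    have "(4 * k - n) div 2 = 2 * k - (n + 1) div 2" "2 * k - (4 * k - n + 1) div 2 = n div 2"
      using that by linarith+
    then show ?thesis
      by (simp add: ins P_path_def)
  qed
  moreover have "ins_shape k d n = (case Q_path k n of (a, b) \<Rightarrow> growth k d a b)"
    if "n \<le> 2 * k" for n
    using that by (simp add: ins Q_path_def)
  ultimately show ?thesis
    using assms(3) by (auto simp: insertion_map_def growth_P_def growth_Q_def simp del: upt_Suc)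
qed

end
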